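(* Let $E_k\subset J^k_n(W)$ be a $0$-crystal PDE. Let $N_0,N_1\subset E_k$ be two closed compact $(n-1)$-dimensional admissible integral manifolds of $E_k$ such that $X\equiv N_0\sqcup N_1\in[0]\in\Omega_{n-1}$ (i.e. $X$ represents the zero class in the unoriented bordism group $\Omega_{n-1}$). Then there exists a smooth solution $V\subset E_k$ such that $\partial V=X$.
   Context: $W$ is a smooth $(n+m)$-dimensional manifold fibered over an $n$-dimensional manifold $M$; $J^k_n(W)$ is the space of $k$-jets of $n$-dimensional submanifolds of $W$ with projections $\pi_{k,h}$ and its Cartan (contact) distribution. A PDE of order $k$ is a submanifold $E_k\subset J^k_n(W)$; here it is assumed formally integrable (all prolongations are smooth submanifolds projecting surjectively, as smooth bundles, onto one another) and completely integrable (through every point there passes a local solution). $E_\infty$ is the infinite prolongation of $E_k$. An integral manifold is a submanifold of $E_k$ tangent to the Cartan distribution; a solution is an admissible $n$-dimensional integral manifold $V\subset E_k$, smooth if it has no singular points. A $p$-dimensional integral manifold $N$ ($0\le p\le n-1$) is admissible if it lies in a solution $V$ and can be deformed in $V$ to $\widetilde N$ diffeomorphic to $\pi_{k,0}(\widetilde N)\subset W$. $\Omega_{n-1}^{E_k}$ is the abelian group (under disjoint union) of compact closed $(n-1)$-dimensional admissible integral manifolds modulo the relation $N_1\sim N_2$ iff there is a smooth solution $V\subset E_k$ with $\partial V=N_1\sqcup N_2$. $\Omega_{n-1}$ is the unoriented bordism group of closed smooth $(n-1)$-manifolds; $\Omega_{n-1}^{E_k}$ maps onto $\Omega_{n-1}$,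 and via this map $\mathbb{R}^{\Omega_{n-1}}=\mathrm{Map}(\Omega_{n-1};\mathbb{R})$ is a subalgebra of $\mathbf{H}_{n-1}(E_k)=\mathrm{Map}(\Omega_{n-1}^{E_k};\mathbb{R})\cong\mathbf{H}_{n-1}(E_\infty)$. The crystal obstruction of $E_k$ is the quotient $cry(E_k)=\mathbf{H}_{n-1}(E_\infty)/\mathbb{R}^{\Omega_{n-1}}$. $E_k$ is a $0$-crystal PDE if $cry(E_k)=0$. *)

theory Defs
  imports "HOL-Analysis.Analysis" "HOL-Algebra.Coset" "HOL-Algebra.Ring"
begin

section \<open>Smooth functions on coordinate spaces\<close>

text \<open>
  Dimensions vary inside the definitions (the dimension of a jet space depends on the order), so
  the Euclidean space with a finite set \<open>I\<close> of coordinates is the set of functions vanishing outside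
  \<open>I\<close>, with the topology induced from the product topology.
\<close>

definition coord_space :: "'i set \<Rightarrow> ('i \<Rightarrow> real) set" where
  "coord_space I = {x. \<forall>i. i \<notin> I \<longrightarrow> x i = 0}"

definition coord_proj :: "'i set \<Rightarrow> ('i \<Rightarrow> real) \<Rightarrow> ('i \<Rightarrow> real)" where
  "coord_proj H x = (\<lambda>i. if i \<in> H then x i else 0)"

definition partial :: "'i \<Rightarrow> (('i \<Rightarrow> real) \<Rightarrow> real) \<Rightarrow> ('i \<Rightarrow> real) \<Rightarrow> real" where
  "partial i f x = deriv (\<lambda>t. f (x(i := t))) (x i)"

primrec partials :: "'i list \<Rightarrow> (('i \<Rightarrow> real) \<Rightarrow> real) \<Rightarrow> ('i \<Rightarrow> real) \<Rightarrow> real" where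
  "partials [] f = f"
| "partials (i # \<sigma>) f = partial i (partials \<sigma> f)"

text \<open>Intended for \<open>D\<close> open in \<open>coord_space I\<close>: all iterated partial derivatives exist and are continuous.\<close>

definition C_inf :: "'i set \<Rightarrow> ('i \<Rightarrow> real) set \<Rightarrow> (('i \<Rightarrow> real) \<Rightarrow> real) \<Rightarrow> bool" where
  "C_inf I D f \<longleftrightarrow>
     (\<forall>\<sigma>. set \<sigma> \<subseteq> I \<longrightarrow>
        continuous_on D (partials \<sigma> f) \<and>
        (\<forall>i\<in>I. \<forall>x\<in>D. (\<lambda>t. partials \<sigma> f (x(i := t))) differentiable (at (x i))))"

text \<open>On an arbitrary subset of a coordinate space (e.g. of a half space) a function is smooth if it
  extends locally to a smooth function on an open set.\<close>

definition smooth_fun :: "'i set \<Rightarrow> ('i \<Rightarrow> real) set \<Rightarrow> (('i \<Rightarrow> real) \<Rightarrow> real) \<Rightarrow> bool" where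
  "smooth_fun I A f \<longleftrightarrow>
     (\<forall>x\<in>A. \<exists>D g. openin (top_of_set (coord_space I)) D \<and> x \<in> D \<and> C_inf I D g \<and>
        (\<forall>y\<in>A \<inter> D. f y = g y))"

definition smooth_coord_map ::
    "'i set \<Rightarrow> 'j set \<Rightarrow> ('i \<Rightarrow> real) set \<Rightarrow> (('i \<Rightarrow> real) \<Rightarrow> ('j \<Rightarrow> real)) \<Rightarrow> bool" where
  "smooth_coord_map I J A f \<longleftrightarrow> (\<forall>j\<in>J. smooth_fun I A (\<lambda>x. f x j))"


section \<open>Smooth manifolds with (possibly empty) boundary\<close>

text \<open>
  A chart is a pair of its domain and its coordinate map. Charts take values in the model space
  where the coordinates in \<open>bdcoords\<close> are nonnegative: a Euclidean space if \<open>bdcoords\<close> is empty, a half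
  space if it is a singleton. The topology is the one determined by the atlas.
\<close>

type_synonym ('a, 'i) chart = "'a set \<times> ('a \<Rightarrow> 'i \<Rightarrow> real)"

record ('a, 'i) mfd =
  points :: "'a set"
  coords :: "'i set"
  bdcoords :: "'i set"
  charts :: "('a, 'i) chart set"

definition model :: "('a, 'i) mfd \<Rightarrow> ('i \<Rightarrow> real) set" where
  "model M = {x \<in> coord_space (coords M). \<forall>i\<in>bdcoords M. 0 \<le> x i}"

definition mfd_top :: "('a, 'i) mfd \<Rightarrow> 'a topology" where
  "mfd_top M = topology (\<lambda>U. U \<subseteq> points M \<and>
     (\<forall>(D, c)\<in>charts M. openin (top_of_set (model M)) (c ` (U \<inter> D))))"

definition local_chart :: "('a, 'i) mfd \<Rightarrow> ('a, 'i) chart \<Rightarrow> bool" where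
  "local_chart M ch \<longleftrightarrow> (case ch of (D, c) \<Rightarrow>
     D \<subseteq> points M \<and> inj_on c D \<and> openin (top_of_set (model M)) (c ` D))"

definition compatible :: "('a, 'i) mfd \<Rightarrow> ('a, 'i) chart \<Rightarrow> ('a, 'i) chart \<Rightarrow> bool" where
  "compatible M ch ch' \<longleftrightarrow> (case ch of (D, c) \<Rightarrow> case ch' of (D', c') \<Rightarrow>
     openin (top_of_set (model M)) (c ` (D \<inter> D')) \<and>
     smooth_coord_map (coords M) (coords M) (c ` (D \<inter> D')) (c' \<circ> inv_into D c))"

definition smooth_manifold :: "('a, 'i) mfd \<Rightarrow> bool" where
  "smooth_manifold M \<longleftrightarrow>
     finite (coords M) \<and> bdcoords M \<subseteq> coords M \<and> card (bdcoords M) \<le> 1 \<and>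
     (\<forall>ch\<in>charts M. local_chart M ch) \<and> \<Union> (fst ` charts M) = points M \<and>
     (\<forall>ch\<in>charts M. \<forall>ch'\<in>charts M. compatible M ch ch') \<and>
     Hausdorff_space (mfd_top M) \<and> second_countable (mfd_top M)"

definition full_atlas :: "('a, 'i) mfd \<Rightarrow> ('a, 'i) chart set" where
  "full_atlas M = {ch. local_chart M ch \<and>
     (\<forall>ch'\<in>charts M. compatible M ch ch' \<and> compatible M ch' ch)}"

definition boundary :: "('a, 'i) mfd \<Rightarrow> 'a set" where
  "boundary M = {p. \<exists>(D, c)\<in>charts M. p \<in> D \<and> (\<exists>i\<in>bdcoords M. c p i = 0)}"

text \<open>Smoothness of a map defined on an arbitrary subset \<open>A\<close> of a manifold; for \<open>A = points M\<close> this is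
  the usual smoothness of maps between manifolds.\<close>

definition smooth_map_on ::
    "('a, 'i) mfd \<Rightarrow> 'a set \<Rightarrow> ('b, 'j) mfd \<Rightarrow> ('a \<Rightarrow> 'b) \<Rightarrow> bool" where
  "smooth_map_on M A N f \<longleftrightarrow> A \<subseteq> points M \<and> f ` A \<subseteq> points N \<and>
     (\<forall>p\<in>A. \<exists>(D, c)\<in>charts M. \<exists>(D', c')\<in>charts N. \<exists>U.
        openin (mfd_top M) U \<and> p \<in> U \<and> U \<subseteq> D \<and> f ` (A \<inter> U) \<subseteq> D' \<and>
        smooth_coord_map (coords M) (coords N) (c ` (A \<inter> U)) (c' \<circ> f \<circ> inv_into D c))"

definition diffeomorphism :: "('a, 'i) mfd \<Rightarrow> ('b, 'j) mfd \<Rightarrow> ('a \<Rightarrow> 'b) \<Rightarrow> bool" where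
  "diffeomorphism M N f \<longleftrightarrow> bij_betw f (points M) (points N) \<and>
     smooth_map_on M (points M) N f \<and>
     smooth_map_on N (points N) M (inv_into (points M) f)"

definition euclid :: "nat \<Rightarrow> (nat \<Rightarrow> real, nat) mfd" where
  "euclid d = \<lparr>points = coord_space {..<d}, coords = {..<d}, bdcoords = {},
     charts = {(coord_space {..<d}, id)}\<rparr>"

text \<open>Used for \<open>d \<ge> 1\<close>.\<close>

definition half_space :: "nat \<Rightarrow> (nat \<Rightarrow> real, nat) mfd" where
  "half_space d = \<lparr>points = {x \<in> coord_space {..<d}. 0 \<le> x 0}, coords = {..<d}, bdcoords = {0},
     charts = {({x \<in> coord_space {..<d}. 0 \<le> x 0}, id)}\<rparr>"

definition real_line :: "(real, unit) mfd" where
  "real_line = \<lparr>points = UNIV, coords = {()}, bdcoords = {}, charts = {(UNIV, \<lambda>t _. t)}\<rparr>"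

definition prod_mfd :: "('a, 'i) mfd \<Rightarrow> ('b, 'j) mfd \<Rightarrow> ('a \<times> 'b, 'i + 'j) mfd" where
  "prod_mfd M N = \<lparr>points = points M \<times> points N, coords = coords M <+> coords N,
     bdcoords = bdcoords M <+> bdcoords N,
     charts = {(D \<times> D', \<lambda>(p, q). case_sum (c p) (c' q)) | D c D' c'.
       (D, c) \<in> charts M \<and> (D', c') \<in> charts N}\<rparr>"

text \<open>Disjoint unions of manifolds modelled on the \<open>d\<close>-dimensional Euclidean space.\<close>

definition disjoint_union :: "nat \<Rightarrow> ('a, nat) mfd list \<Rightarrow> (nat \<times> 'a, nat) mfd" where
  "disjoint_union d Ms = \<lparr>points = (SIGMA i:{..<length Ms}. points (Ms ! i)),
     coords = {..<d}, bdcoords = {},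
     charts = {({i} \<times> D, c \<circ> snd) | i D c. i < length Ms \<and> (D, c) \<in> charts (Ms ! i)}\<rparr>"

definition disjoint_sum :: "('a, 'i) mfd \<Rightarrow> ('b, 'i) mfd \<Rightarrow> ('a + 'b, 'i) mfd" where
  "disjoint_sum M N = \<lparr>points = points M <+> points N, coords = coords M, bdcoords = bdcoords M,
     charts = {(Inl ` D, c \<circ> projl) | D c. (D, c) \<in> charts M} \<union>
              {(Inr ` D, c \<circ> projr) | D c. (D, c) \<in> charts N}\<rparr>"


section \<open>Submanifolds\<close>

text \<open>
  The subset \<open>S\<close> of \<open>M\<close> is an (embedded) submanifold modelled on \<open>Q\<close> if it is locally diffeomorphic to
  open subsets of \<open>Q\<close>, smoothness of maps on subsets of \<open>M\<close> being understood as above. Here \<open>Q\<close> is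
  \<open>euclid d\<close>, or \<open>half_space d\<close> to allow a boundary.
\<close>

definition sub_charts :: "('q, 'j) mfd \<Rightarrow> ('a, 'i) mfd \<Rightarrow> 'a set \<Rightarrow> ('a set \<times> ('a \<Rightarrow> 'q)) set" where
  "sub_charts Q M S = {(U, c). openin (subtopology (mfd_top M) S) U \<and> inj_on c U \<and>
     openin (mfd_top Q) (c ` U) \<and>
     smooth_map_on M U Q c \<and> smooth_map_on Q (c ` U) M (inv_into U c)}"

definition submanifold :: "('q, 'j) mfd \<Rightarrow> ('a, 'i) mfd \<Rightarrow> 'a set \<Rightarrow> bool" where
  "submanifold Q M S \<longleftrightarrow> S \<subseteq> points M \<and> \<Union> (fst ` sub_charts Q M S) = S"

definition submfd :: "(nat \<Rightarrow> real, nat) mfd \<Rightarrow> ('a, 'i) mfd \<Rightarrow> 'a set \<Rightarrow> ('a, nat) mfd" where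
  "submfd Q M S = \<lparr>points = S, coords = coords Q, bdcoords = bdcoords Q,
     charts = sub_charts Q M S\<rparr>"


section \<open>Tangent vectors, immersions, bundles\<close>

text \<open>
  A tangent vector is given by its components in a chart and realised as the one-sided velocity of
  a curve. One-sidedness makes this apply at boundary points as well, where the inward vectors
  obtained span the tangent space. Only the values of the curve for small \<open>t \<ge> 0\<close> matter.
\<close>

definition has_velocity :: "('a, 'i) chart \<Rightarrow> (real \<Rightarrow> 'a) \<Rightarrow> ('i \<Rightarrow> real) \<Rightarrow> bool" where
  "has_velocity ch \<gamma> v \<longleftrightarrow> (case ch of (D, c) \<Rightarrow>
     \<gamma> 0 \<in> D \<and> (\<forall>\<^sub>F t in at_right 0. \<gamma> t \<in> D) \<and>
     (\<forall>i. ((\<lambda>t. c (\<gamma> t) i) has_real_derivative v i) (at_right 0)))"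

definition curve_in :: "'a set \<Rightarrow> (real \<Rightarrow> 'a) \<Rightarrow> bool" where
  "curve_in A \<gamma> \<longleftrightarrow> (\<forall>t\<ge>0. \<gamma> t \<in> A)"

definition tangent :: "'a set \<Rightarrow> 'a \<Rightarrow> ('a, 'i) chart \<Rightarrow> ('i \<Rightarrow> real) set" where
  "tangent A p ch = {v. \<exists>\<gamma>. curve_in A \<gamma> \<and> \<gamma> 0 = p \<and> has_velocity ch \<gamma> v}"

definition immersion :: "('a, 'i) mfd \<Rightarrow> ('b, 'j) mfd \<Rightarrow> ('a \<Rightarrow> 'b) \<Rightarrow> bool" where
  "immersion M N f \<longleftrightarrow> smooth_map_on M (points M) N f \<and>
     (\<forall>ch\<in>charts M. \<forall>ch'\<in>charts N. \<forall>\<gamma> v.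
        curve_in (points M) \<gamma> \<and> has_velocity ch \<gamma> v \<and> has_velocity ch' (f \<circ> \<gamma>) (\<lambda>_. 0)
        \<longrightarrow> v = (\<lambda>_. 0))"

definition lin_span :: "('i \<Rightarrow> real) set \<Rightarrow> ('i \<Rightarrow> real) set" where
  "lin_span A = \<Inter> {S. A \<subseteq> S \<and> (\<lambda>_. 0) \<in> S \<and>
     (\<forall>u\<in>S. \<forall>w\<in>S. \<forall>r. (\<lambda>i. r * u i + w i) \<in> S)}"

text \<open>Smooth, surjective and locally trivial.\<close>

definition smooth_bundle :: "('a, 'i) mfd \<Rightarrow> ('b, 'j) mfd \<Rightarrow> ('a \<Rightarrow> 'b) \<Rightarrow> bool" where
  "smooth_bundle P B f \<longleftrightarrow>
     smooth_map_on P (points P) B f \<and> f ` points P = points B \<and>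
     (\<forall>b\<in>points B. \<exists>e U \<Phi>.
        let F = {p \<in> points P. f p = b}; Z = {p \<in> points P. f p \<in> U};
            T = prod_mfd B (submfd (euclid e) P F)
        in submanifold (euclid e) P F \<and> openin (mfd_top B) U \<and> b \<in> U \<and>
           bij_betw \<Phi> Z (U \<times> F) \<and> (\<forall>p\<in>Z. fst (\<Phi> p) = f p) \<and>
           smooth_map_on P Z T \<Phi> \<and> smooth_map_on T (U \<times> F) P (inv_into Z \<Phi>))"

text \<open>\<open>W\<close> has dimension \<open>n + m\<close>, \<open>M\<close> has dimension \<open>n\<close> and \<open>pr\<close> is a surjective submersion, i.e. in
  suitable charts it is the projection onto the first \<open>n\<close> coordinates.\<close>

definition fibered_manifold ::
    "nat \<Rightarrow> nat \<Rightarrow> ('w, nat) mfd \<Rightarrow> ('m, nat) mfd \<Rightarrow> ('w \<Rightarrow> 'm) \<Rightarrow> bool" where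
  "fibered_manifold n m W M pr \<longleftrightarrow>
     smooth_manifold M \<and> coords M = {..<n} \<and> bdcoords M = {} \<and>
     smooth_manifold W \<and> coords W = {..<n + m} \<and> bdcoords W = {} \<and>
     smooth_map_on W (points W) M pr \<and> pr ` points W = points M \<and>
     (\<forall>p\<in>points W. \<exists>(D, c)\<in>full_atlas W. \<exists>(D', c')\<in>full_atlas M.
        p \<in> D \<and> pr ` D \<subseteq> D' \<and> (\<forall>q\<in>D. c' (pr q) = coord_proj {..<n} (c q)))"


section \<open>Jets of submanifolds\<close>

text \<open>Near \<open>a\<close>, in the given chart of \<open>M\<close>, the set \<open>L\<close> is the graph of \<open>f\<close> over the coordinates \<open>H\<close>.\<close>

definition graph_near ::
    "('a, 'i) mfd \<Rightarrow> 'i set \<Rightarrow> ('a, 'i) chart \<Rightarrow> 'a set \<Rightarrow> 'a \<Rightarrow> ('i \<Rightarrow> ('i \<Rightarrow> real) \<Rightarrow> real) \<Rightarrow> bool" where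
  "graph_near M H ch L a f \<longleftrightarrow> ch \<in> full_atlas M \<and> H \<subseteq> coords M \<and> (case ch of (D, c) \<Rightarrow>
     a \<in> L \<inter> D \<and>
     (\<exists>U O'. openin (mfd_top M) U \<and> a \<in> U \<and> U \<subseteq> D \<and>
        openin (top_of_set (coord_space H)) O' \<and>
        (\<forall>j\<in>coords M - H. C_inf H O' (f j)) \<and>
        (\<forall>p\<in>U. coord_proj H (c p) \<in> O' \<and>
          (p \<in> L \<longleftrightarrow> (\<forall>j\<in>coords M - H. c p j = f j (coord_proj H (c p)))))))"

text \<open>Contact of order \<open>k\<close> at \<open>a\<close> of \<open>n\<close>-dimensional submanifolds of \<open>M\<close>.\<close>

definition contact :: "('a, 'i) mfd \<Rightarrow> nat \<Rightarrow> nat \<Rightarrow> 'a \<Rightarrow> 'a set \<Rightarrow> 'a set \<Rightarrow> bool" where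
  "contact M n k a L L' \<longleftrightarrow>
     (\<exists>H ch f g. card H = n \<and> graph_near M H ch L a f \<and> graph_near M H ch L' a g \<and>
        (\<forall>j\<in>coords M - H. \<forall>\<sigma>. set \<sigma> \<subseteq> H \<and> length \<sigma> \<le> k \<longrightarrow>
           partials \<sigma> (f j) (coord_proj H (snd ch a)) =
           partials \<sigma> (g j) (coord_proj H (snd ch a))))"

text \<open>The \<open>k\<close>-jet of \<open>L\<close> at \<open>a\<close>: the point \<open>a\<close> with the class of all submanifolds having contact of
  order \<open>k\<close> with \<open>L\<close> at \<open>a\<close>.\<close>

type_synonym 'w jet = "'w \<times> 'w set set"

definition jet :: "('w, nat) mfd \<Rightarrow> nat \<Rightarrow> nat \<Rightarrow> 'w set \<Rightarrow> 'w \<Rightarrow> 'w jet" where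
  "jet W n k L a = (a, {L'. submanifold (euclid n) W L' \<and> a \<in> L' \<and> contact W n k a L L'})"

text \<open>
  A chart of \<open>W\<close> with coordinates \<open>x\<^sub>0, \<dots>\<close> induces a chart of the jet space on the jets of graphs over
  the first \<open>n\<close> coordinates: \<open>Inl i\<close> is the coordinate \<open>x\<^sub>i\<close> and \<open>Inr (j, \<sigma>)\<close> is the partial derivative of
  the \<open>j\<close>-th component along the multi-index \<open>\<sigma>\<close>, written as a sorted list. Every jet lies in the domain
  of such a chart since charts of \<open>W\<close> with permuted coordinates belong to the full atlas.
\<close>

type_synonym jidx = "nat + nat \<times> nat list"

definition jet_coords :: "('w, nat) mfd \<Rightarrow> nat \<Rightarrow> nat \<Rightarrow> jidx set" where
  "jet_coords W n k = {..<n} <+>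
     {(j, \<sigma>). j \<in> coords W - {..<n} \<and> sorted \<sigma> \<and> set \<sigma> \<subseteq> {..<n} \<and> length \<sigma> \<le> k}"

definition jet_chart :: "('w, nat) mfd \<Rightarrow> nat \<Rightarrow> nat \<Rightarrow> ('w, nat) chart \<Rightarrow> ('w jet, jidx) chart" where
  "jet_chart W n k ch =
     ({jet W n k L a | L a. submanifold (euclid n) W L \<and> a \<in> L \<and> (\<exists>f. graph_near W {..<n} ch L a f)},
      \<lambda>\<theta>. let f = (SOME f. \<exists>L\<in>snd \<theta>. graph_near W {..<n} ch L (fst \<theta>) f);
              x = snd ch (fst \<theta>)
          in coord_proj (jet_coords W n k)
               (case_sum x (\<lambda>(j, \<sigma>). partials \<sigma> (f j) (coord_proj {..<n} x))))"

definition jet_space :: "('w, nat) mfd \<Rightarrow> nat \<Rightarrow> nat \<Rightarrow> ('w jet, jidx) mfd" where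
  "jet_space W n k = \<lparr>
     points = {jet W n k L a | L a. submanifold (euclid n) W L \<and> a \<in> L},
     coords = jet_coords W n k, bdcoords = {},
     charts = jet_chart W n k ` full_atlas W\<rparr>"

text \<open>The projection onto jets of lower order \<open>h\<close>. The projection onto \<open>W\<close>, identified with the space
  of jets of order 0, is \<open>fst\<close>.\<close>

definition jet_proj :: "('w, nat) mfd \<Rightarrow> nat \<Rightarrow> nat \<Rightarrow> 'w jet \<Rightarrow> 'w jet" where
  "jet_proj W n h \<theta> = jet W n h (SOME L. L \<in> snd \<theta>) (fst \<theta>)"

definition jet_lift :: "('w, nat) mfd \<Rightarrow> nat \<Rightarrow> nat \<Rightarrow> 'w set \<Rightarrow> 'w jet set" where
  "jet_lift W n k L = jet W n k L ` L"

text \<open>The plane of the Cartan distribution at \<open>\<theta>\<close> is spanned by the tangent spaces of the \<open>k\<close>-jet lifts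
  of all submanifolds representing \<open>\<theta>\<close>.\<close>

definition cartan :: "('w, nat) mfd \<Rightarrow> nat \<Rightarrow> nat \<Rightarrow> 'w jet \<Rightarrow> ('w jet, jidx) chart \<Rightarrow> (jidx \<Rightarrow> real) set" where
  "cartan W n k \<theta> ch = lin_span (\<Union>L\<in>snd \<theta>. tangent (jet_lift W n k L) \<theta> ch)"


section \<open>Partial differential equations\<close>

definition is_pde :: "('w, nat) mfd \<Rightarrow> nat \<Rightarrow> nat \<Rightarrow> 'w jet set \<Rightarrow> bool" where
  "is_pde W n k E \<longleftrightarrow> (\<exists>d. submanifold (euclid d) (jet_space W n k) E)"

text \<open>The \<open>l\<close>-th prolongation consists of the jets of order \<open>k + l\<close> of those \<open>L\<close> whose lift has contact of
  order \<open>l\<close> with an \<open>n\<close>-dimensional submanifold of \<open>E\<close>, i.e. it is the intersection of the \<open>l\<close>-jets of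
  \<open>n\<close>-dimensional submanifolds of \<open>E\<close> with the \<open>(k + l)\<close>-jets of submanifolds of \<open>W\<close>.\<close>

definition prolongation :: "('w, nat) mfd \<Rightarrow> nat \<Rightarrow> nat \<Rightarrow> 'w jet set \<Rightarrow> nat \<Rightarrow> 'w jet set" where
  "prolongation W n k E l = (if l = 0 then E else
     {jet W n (k + l) L a | L a. submanifold (euclid n) W L \<and> a \<in> L \<and>
        (\<exists>K. submanifold (euclid n) (jet_space W n k) K \<and> K \<subseteq> E \<and> jet W n k L a \<in> K \<and>
           contact (jet_space W n k) n l (jet W n k L a) (jet_lift W n k L) K)})"

definition formally_integrable :: "('w, nat) mfd \<Rightarrow> nat \<Rightarrow> nat \<Rightarrow> 'w jet set \<Rightarrow> bool" where
  "formally_integrable W n k E \<longleftrightarrow>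
     (\<exists>d. \<forall>l. submanifold (euclid (d l)) (jet_space W n (k + l)) (prolongation W n k E l) \<and>
        smooth_bundle
          (submfd (euclid (d (Suc l))) (jet_space W n (k + Suc l)) (prolongation W n k E (Suc l)))
          (submfd (euclid (d l)) (jet_space W n (k + l)) (prolongation W n k E l))
          (jet_proj W n (k + l)))"

text \<open>Integral manifolds modelled on \<open>Q\<close>.\<close>

definition integral_manifold ::
    "(nat \<Rightarrow> real, nat) mfd \<Rightarrow> ('w, nat) mfd \<Rightarrow> nat \<Rightarrow> nat \<Rightarrow> 'w jet set \<Rightarrow> 'w jet set \<Rightarrow> bool" where
  "integral_manifold Q W n k E N \<longleftrightarrow> submanifold Q (jet_space W n k) N \<and> N \<subseteq> E \<and>
     (\<forall>\<theta>\<in>N. \<forall>ch\<in>charts (jet_space W n k). \<theta> \<in> fst ch \<longrightarrow> tangent N \<theta> ch \<subseteq> cartan W n k \<theta> ch)"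

text \<open>Points where the projection to \<open>W\<close> annihilates a nonzero tangent vector of \<open>V\<close>.\<close>

definition singular_points :: "('w, nat) mfd \<Rightarrow> nat \<Rightarrow> nat \<Rightarrow> 'w jet set \<Rightarrow> 'w jet set" where
  "singular_points W n k V = {\<theta>. \<exists>ch\<in>charts (jet_space W n k). \<exists>ch'\<in>charts W. \<exists>\<gamma> v.
     curve_in V \<gamma> \<and> \<gamma> 0 = \<theta> \<and> has_velocity ch \<gamma> v \<and> v \<noteq> (\<lambda>_. 0) \<and>
     has_velocity ch' (fst \<circ> \<gamma>) (\<lambda>_. 0)}"

text \<open>Admissibility of an \<open>n\<close>-dimensional integral manifold: its singular points are nowhere dense.\<close>

definition solution :: "('w, nat) mfd \<Rightarrow> nat \<Rightarrow> nat \<Rightarrow> 'w jet set \<Rightarrow> 'w jet set \<Rightarrow> bool" where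
  "solution W n k E V \<longleftrightarrow> integral_manifold (half_space n) W n k E V \<and>
     (let X = subtopology (mfd_top (jet_space W n k)) V
      in X interior_of (X closure_of singular_points W n k V) = {})"

definition completely_integrable :: "('w, nat) mfd \<Rightarrow> nat \<Rightarrow> nat \<Rightarrow> 'w jet set \<Rightarrow> bool" where
  "completely_integrable W n k E \<longleftrightarrow> (\<forall>\<theta>\<in>E. \<exists>V. solution W n k E V \<and> \<theta> \<in> V)"

text \<open>Admissibility of a \<open>p\<close>-dimensional integral manifold: \<open>h\<close> is a smooth isotopy of \<open>N\<close> inside the
  solution \<open>V\<close> to a submanifold that \<open>fst\<close> maps diffeomorphically onto a submanifold of \<open>W\<close>.\<close>

definition admissible :: "('w, nat) mfd \<Rightarrow> nat \<Rightarrow> nat \<Rightarrow> nat \<Rightarrow> 'w jet set \<Rightarrow> 'w jet set \<Rightarrow> bool" where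
  "admissible W n k p E N \<longleftrightarrow> integral_manifold (euclid p) W n k E N \<and>
     (\<exists>V h. solution W n k E V \<and> N \<subseteq> V \<and>
        smooth_map_on (prod_mfd real_line (jet_space W n k)) ({0..1} \<times> N) (jet_space W n k)
          (\<lambda>(t, \<theta>). h t \<theta>) \<and>
        (\<forall>\<theta>\<in>N. h 0 \<theta> = \<theta>) \<and>
        (\<forall>t\<in>{0..1}. h t ` N \<subseteq> V \<and> submanifold (euclid p) (jet_space W n k) (h t ` N) \<and>
           diffeomorphism (submfd (euclid p) (jet_space W n k) N)
             (submfd (euclid p) (jet_space W n k) (h t ` N)) (h t)) \<and>
        submanifold (euclid p) W (fst ` h 1 ` N) \<and>
        diffeomorphism (submfd (euclid p) (jet_space W n k) (h 1 ` N))
          (submfd (euclid p) W (fst ` h 1 ` N)) fst)"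

definition closed_admissible :: "('w, nat) mfd \<Rightarrow> nat \<Rightarrow> nat \<Rightarrow> 'w jet set \<Rightarrow> 'w jet set set" where
  "closed_admissible W n k E =
     {N. admissible W n k (n - 1) E N \<and> compactin (mfd_top (jet_space W n k)) N}"


section \<open>Unoriented bordism\<close>

text \<open>
  A Hausdorff second countable manifold has at most continuum many points, so manifolds carried by
  sets of reals represent all manifolds up to diffeomorphism.
\<close>

definition closed_manifold :: "nat \<Rightarrow> ('a, nat) mfd \<Rightarrow> bool" where
  "closed_manifold d P \<longleftrightarrow> smooth_manifold P \<and> coords P = {..<d} \<and> bdcoords P = {} \<and>
     compact_space (mfd_top P)"

definition compact_bounded_manifold :: "nat \<Rightarrow> ('a, nat) mfd \<Rightarrow> bool" where
  "compact_bounded_manifold d B \<longleftrightarrow> smooth_manifold B \<and> coords B = {..<d} \<and> bdcoords B = {0} \<and>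
     compact_space (mfd_top B)"

definition boundary_mfd :: "nat \<Rightarrow> ('a, nat) mfd \<Rightarrow> ('a, nat) mfd" where
  "boundary_mfd d B = submfd (euclid (d - 1)) B (boundary B)"

definition bordant :: "nat \<Rightarrow> ('a, nat) mfd \<Rightarrow> ('b, nat) mfd \<Rightarrow> bool" where
  "bordant d P Q \<longleftrightarrow> (\<exists>(B :: (real, nat) mfd) \<phi>. compact_bounded_manifold (Suc d) B \<and>
     diffeomorphism (disjoint_sum P Q) (boundary_mfd (Suc d) B) \<phi>)"

definition bordism_class :: "nat \<Rightarrow> ('a, nat) mfd \<Rightarrow> (real, nat) mfd set" where
  "bordism_class d P = {Q. closed_manifold d Q \<and> bordant d P Q}"

definition bordism_group :: "nat \<Rightarrow> (real, nat) mfd set set" where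
  "bordism_group d = bordism_class d ` {P :: (real, nat) mfd. closed_manifold d P}"

definition empty_mfd :: "nat \<Rightarrow> ('a, nat) mfd" where
  "empty_mfd d = \<lparr>points = {}, coords = {..<d}, bdcoords = {}, charts = {}\<rparr>"

definition bordism_zero :: "nat \<Rightarrow> (real, nat) mfd set" where
  "bordism_zero d = bordism_class d (empty_mfd d :: (real, nat) mfd)"


section \<open>Integral bordism and the crystal obstruction\<close>

text \<open>
  A smooth solution with boundary is given by a compact manifold \<open>V\<close> and a map \<open>F\<close> identifying it with a
  subset of \<open>E\<close>: an immersion tangent to the Cartan distribution, without singular points, and
  injective except that boundary points may share their image. This exception matters only if the
  prescribed boundary pieces intersect, as in a disjoint union of a manifold with itself; otherwise
  \<open>F\<close> is an embedding.
\<close>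

definition smooth_solution ::
    "('w, nat) mfd \<Rightarrow> nat \<Rightarrow> nat \<Rightarrow> 'w jet set \<Rightarrow> (real, nat) mfd \<Rightarrow> (real \<Rightarrow> 'w jet) \<Rightarrow> bool" where
  "smooth_solution W n k E V F \<longleftrightarrow> compact_bounded_manifold n V \<and>
     F ` points V \<subseteq> E \<and>
     (\<forall>x\<in>points V. \<forall>y\<in>points V. F x = F y \<longrightarrow> x = y \<or> x \<in> boundary V \<and> y \<in> boundary V) \<and>
     immersion V (jet_space W n k) F \<and>
     (\<forall>ch\<in>charts V. \<forall>ch'\<in>charts (jet_space W n k). \<forall>\<gamma> u v.
        curve_in (points V) \<gamma> \<and> has_velocity ch \<gamma> u \<and> has_velocity ch' (F \<circ> \<gamma>) v
        \<longrightarrow> v \<in> cartan W n k (F (\<gamma> 0)) ch') \<and>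
     immersion V W (fst \<circ> F)"

text \<open>Formal disjoint unions of integral manifolds, which may intersect as subsets of \<open>E\<close>, are lists.\<close>

definition family_mfd :: "('w, nat) mfd \<Rightarrow> nat \<Rightarrow> nat \<Rightarrow> 'w jet set list \<Rightarrow> (nat \<times> 'w jet, nat) mfd" where
  "family_mfd W n k Ns =
     disjoint_union (n - 1) (map (submfd (euclid (n - 1)) (jet_space W n k)) Ns)"

definition has_boundary ::
    "('w, nat) mfd \<Rightarrow> nat \<Rightarrow> nat \<Rightarrow> (real, nat) mfd \<Rightarrow> (real \<Rightarrow> 'w jet) \<Rightarrow> 'w jet set list \<Rightarrow> bool" where
  "has_boundary W n k V F Ns \<longleftrightarrow>
     (\<exists>\<phi>. diffeomorphism (family_mfd W n k Ns) (boundary_mfd n V) \<phi> \<and>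
        (\<forall>z\<in>points (family_mfd W n k Ns). F (\<phi> z) = snd z))"

definition integral_bordism :: "('w, nat) mfd \<Rightarrow> nat \<Rightarrow> nat \<Rightarrow> 'w jet set \<Rightarrow> 'w jet set list rel" where
  "integral_bordism W n k E = {(Ns, Ms).
     Ns \<in> lists (closed_admissible W n k E) \<and> Ms \<in> lists (closed_admissible W n k E) \<and>
     (\<exists>V F. smooth_solution W n k E V F \<and> has_boundary W n k V F (Ns @ Ms))}"

text \<open>Integral bordism is taken to be an equivalence relation, as in the notion of a bordism group; the
  quotient is formed by its classes, without passing to a generated equivalence relation, under
  which members of the same class need not be joined by a single solution.\<close>

definition integral_class ::
    "('w, nat) mfd \<Rightarrow> nat \<Rightarrow> nat \<Rightarrow> 'w jet set \<Rightarrow> 'w jet set list \<Rightarrow> 'w jet set list set" where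
  "integral_class W n k E Ns = integral_bordism W n k E `` {Ns}"

definition integral_bordism_group ::
    "('w, nat) mfd \<Rightarrow> nat \<Rightarrow> nat \<Rightarrow> 'w jet set \<Rightarrow> 'w jet set list set set" where
  "integral_bordism_group W n k E = lists (closed_admissible W n k E) // integral_bordism W n k E"

text \<open>The algebra of real functions on a set under pointwise operations.\<close>

definition function_algebra :: "'c set \<Rightarrow> ('c \<Rightarrow> real) ring" where
  "function_algebra S = \<lparr>carrier = S \<rightarrow>\<^sub>E UNIV,
     mult = (\<lambda>f g. \<lambda>s\<in>S. f s * g s), one = (\<lambda>s\<in>S. 1),
     zero = (\<lambda>s\<in>S. 0), add = (\<lambda>f g. \<lambda>s\<in>S. f s + g s)\<rparr>"

definition H_alg :: "('w, nat) mfd \<Rightarrow> nat \<Rightarrow> nat \<Rightarrow> 'w jet set \<Rightarrow> ('w jet set list set \<Rightarrow> real) ring" where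
  "H_alg W n k E = function_algebra (integral_bordism_group W n k E)"

text \<open>
  The subalgebra of functions on the unoriented bordism group, i.e. the image of the pullback along the
  homomorphism that sends the integral bordism class of \<open>Ns\<close> to its unoriented bordism class. The
  values of \<open>\<phi>\<close> outside \<open>bordism_group (n - 1)\<close> are irrelevant.
\<close>

definition bordism_functions ::
    "('w, nat) mfd \<Rightarrow> nat \<Rightarrow> nat \<Rightarrow> 'w jet set \<Rightarrow> ('w jet set list set \<Rightarrow> real) set" where
  "bordism_functions W n k E = {g \<in> carrier (H_alg W n k E).
     \<exists>\<phi> \<in> bordism_group (n - 1) \<rightarrow> UNIV.
       \<forall>Ns\<in>lists (closed_admissible W n k E).
         g (integral_class W n k E Ns) = \<phi> (bordism_class (n - 1) (family_mfd W n k Ns))}"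

text \<open>
  The algebra of the infinite prolongation of \<open>E\<close> is identified with \<open>H_alg\<close> by the canonical
  isomorphism between them. The quotient by the subalgebra is a quotient of additive groups; its
  elements are the cosets.
\<close>

definition cry ::
    "('w, nat) mfd \<Rightarrow> nat \<Rightarrow> nat \<Rightarrow> 'w jet set \<Rightarrow> ('w jet set list set \<Rightarrow> real) set monoid" where
  "cry W n k E = add_monoid (H_alg W n k E) Mod bordism_functions W n k E"

definition zero_crystal :: "('w, nat) mfd \<Rightarrow> nat \<Rightarrow> nat \<Rightarrow> 'w jet set \<Rightarrow> bool" where
  "zero_crystal W n k E \<longleftrightarrow> carrier (cry W n k E) = {\<one>\<^bsub>cry W n k E\<^esub>}"

end

theory Submission
  imports Defs
begin

text \<open>
  The quotient of the algebra of functions on the integral bordism group by the functions that come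
  from unoriented bordism is trivial only if \<^emph>\<open>every\<close> function on the integral bordism group comes
  from unoriented bordism (\<open>zero_crystal_imp_bordism_function\<close>). Indicator functions then show that
  the unoriented class of a family of closed admissible integral manifolds determines its integral
  class (\<open>zero_crystal_imp_integral_class_eq\<close>).

  Compare \<open>[N0, N1]\<close> with the empty family. Both have unoriented class zero, hence the same integral
  class. The empty solution bounds the empty family, so the empty family belongs to this common class,
  which says that some solution has boundary \<open>[N0, N1] @ []\<close>.

  The only other matter is one of representation: the zero class is defined by an empty manifold whose
  points are real numbers, whereas the empty family has pairs of an index and a jet as points. That
  empty manifolds of different types have the same bordism class follows by relabelling points
  (\<open>bordism_class_empty_mfd\<close>).
\<close>


section \<open>Relabelling the points of a manifold\<close>

lemma openin_mfd_top:
  assumes inj: "\<And>D c. (D, c) \<in> charts M \<Longrightarrow> inj_on c D"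
  shows "openin (mfd_top M) U \<longleftrightarrow> U \<subseteq> points M \<and>
     (\<forall>(D, c)\<in>charts M. openin (top_of_set (model M)) (c ` (U \<inter> D)))"
proof -
  let ?L = "\<lambda>U. U \<subseteq> points M \<and>
     (\<forall>(D, c)\<in>charts M. openin (top_of_set (model M)) (c ` (U \<inter> D)))"
  have "istopology ?L"
    unfolding istopology_def
  proof (intro conjI allI impI)
    fix S T assume S: "?L S" and T: "?L T"
    \<comment> \<open>Injectivity of the charts is what makes images commute with intersections.\<close>
    have "c ` (S \<inter> T \<inter> D) = c ` (S \<inter> D) \<inter> c ` (T \<inter> D)" if "(D, c) \<in> charts M" for D c
      using inj[OF that] by (auto simp: inj_on_def)
    with S T show "\<forall>(D, c)\<in>charts M. openin (top_of_set (model M)) (c ` (S \<inter> T \<inter> D))"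
      by (auto intro!: openin_Int)
    show "S \<inter> T \<subseteq> points M" using S by blast
  next
    fix \<K> assume K: "\<forall>K\<in>\<K>. ?L K"
    then show "\<Union>\<K> \<subseteq> points M" by blast
    have "c ` (\<Union>\<K> \<inter> D) = (\<Union>K\<in>\<K>. c ` (K \<inter> D))" for c :: "'a \<Rightarrow> 'b \<Rightarrow> real" and D by blast
    with K show "\<forall>(D, c)\<in>charts M. openin (top_of_set (model M)) (c ` (\<Union>\<K> \<inter> D))"
      by (fastforce intro!: openin_Union)
  qed
  then show ?thesis by (simp add: mfd_top_def topology_inverse')
qed

lemma smooth_coord_map_cong:
  assumes "smooth_coord_map I J A f" "\<And>x. x \<in> A \<Longrightarrow> f x = g x"
  shows "smooth_coord_map I J A g"
  using assms unfolding smooth_coord_map_def smooth_fun_def by (metis IntE)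

text \<open>The manifold structure transported along \<open>r\<close>, where \<open>s\<close> is a left inverse of \<open>r\<close> on the points.\<close>

definition relabel :: "('a \<Rightarrow> 'b) \<Rightarrow> ('b \<Rightarrow> 'a) \<Rightarrow> ('a, 'i) mfd \<Rightarrow> ('b, 'i) mfd" where
  "relabel r s M = \<lparr>points = r ` points M, coords = coords M, bdcoords = bdcoords M,
     charts = (\<lambda>(D, c). (r ` D, c \<circ> s)) ` charts M\<rparr>"

context
  fixes M :: "('a, 'i) mfd" and N :: "('c, 'j) mfd" and r :: "'a \<Rightarrow> 'b" and s :: "'b \<Rightarrow> 'a"
  assumes left_inverse: "\<And>x. x \<in> points M \<Longrightarrow> s (r x) = x"
    and charts_M: "\<And>D c. (D, c) \<in> charts M \<Longrightarrow> D \<subseteq> points M \<and> inj_on c D"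
begin

lemma relabel_image:
  assumes "A \<subseteq> points M" "B \<subseteq> points M"
  shows "(c \<circ> s) ` (r ` A \<inter> r ` B) = c ` (A \<inter> B)"
proof -
  have "inj_on r (points M)" by (metis inj_onI left_inverse)
  then have "r ` A \<inter> r ` B = r ` (A \<inter> B)" using assms by (metis inj_on_image_Int)
  moreover have "s (r x) = x" if "x \<in> A \<inter> B" for x using that assms left_inverse by blast
  ultimately show ?thesis by (simp add: image_comp [symmetric] image_image)
qed

lemma inj_on_relabel_chart: "(D, c) \<in> charts M \<Longrightarrow> inj_on (c \<circ> s) (r ` D)"
proof -
  assume ch: "(D, c) \<in> charts M"
  then have sr: "s (r x) = x" if "x \<in> D" for x using that charts_M left_inverse by blast
  then have "s ` r ` D = D" by (simp add: image_image)
  moreover have "inj_on s (r ` D)" using sr by (auto intro!: inj_onI)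
  ultimately show ?thesis using charts_M[OF ch] by (simp add: comp_inj_on)
qed

lemma openin_relabel:
  assumes "openin (mfd_top M) U"
  shows "openin (mfd_top (relabel r s M)) (r ` U)"
proof -
  have U: "U \<subseteq> points M" "\<forall>(D, c)\<in>charts M. openin (top_of_set (model M)) (c ` (U \<inter> D))"
    using assms openin_mfd_top[of M U] charts_M by blast+
  have model: "model (relabel r s M) = model M" by (simp add: model_def relabel_def)
  have inj: "inj_on c' D'" if "(D', c') \<in> charts (relabel r s M)" for D' c'
    using that inj_on_relabel_chart by (auto simp: relabel_def)
  have "openin (top_of_set (model M)) ((c \<circ> s) ` (r ` U \<inter> r ` D))" if "(D, c) \<in> charts M" for D c
    using U that charts_M relabel_image[of U D c] by auto
  then have "\<forall>(D', c')\<in>charts (relabel r s M).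
      openin (top_of_set (model (relabel r s M))) (c' ` (r ` U \<inter> D'))"
    unfolding model by (auto simp: relabel_def)
  moreover have "r ` U \<subseteq> points (relabel r s M)" using U by (auto simp: relabel_def)
  ultimately show ?thesis using openin_mfd_top[of "relabel r s M" "r ` U"] inj by blast
qed

text \<open>In the charts \<open>c \<circ> s\<close> a map out of or into the relabelled manifold has the same coordinate
  expression as the original map in the charts \<open>c\<close>, so smoothness carries over chart by chart.\<close>

lemma smooth_map_on_from_relabel:
  assumes f: "smooth_map_on M A N f" and g: "\<And>x. x \<in> A \<Longrightarrow> g (r x) = f x"
  shows "smooth_map_on (relabel r s M) (r ` A) N g"
  unfolding smooth_map_on_def
proof (intro conjI ballI)
  have A: "A \<subseteq> points M" using f by (simp add: smooth_map_on_def)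
  then show "r ` A \<subseteq> points (relabel r s M)" by (auto simp: relabel_def)
  show "g ` r ` A \<subseteq> points N" using f g by (auto simp: smooth_map_on_def)
  fix p' assume "p' \<in> r ` A"
  then obtain p where p: "p \<in> A" "p' = r p" by blast
  then obtain D c D' c' U where ch: "(D, c) \<in> charts M" "(D', c') \<in> charts N"
    and U: "openin (mfd_top M) U" "p \<in> U" "U \<subseteq> D" "f ` (A \<inter> U) \<subseteq> D'"
    and sm: "smooth_coord_map (coords M) (coords N) (c ` (A \<inter> U)) (c' \<circ> f \<circ> inv_into D c)"
    using f unfolding smooth_map_on_def by fast
  have D: "D \<subseteq> points M" "inj_on c D" using charts_M[OF ch(1)] by auto
  have Int: "r ` A \<inter> r ` U = r ` (A \<inter> U)"
    using A U D inj_on_inverseI[of "points M" s r, OF left_inverse]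
    by (metis inj_on_image_Int subset_trans)
  have img: "(c \<circ> s) ` (r ` A \<inter> r ` U) = c ` (A \<inter> U)"
    using relabel_image[of A U c] A U D by blast
  have "smooth_coord_map (coords M) (coords N) (c ` (A \<inter> U)) (c' \<circ> g \<circ> inv_into (r ` D) (c \<circ> s))"
  proof (rule smooth_coord_map_cong[OF sm])
    fix y assume "y \<in> c ` (A \<inter> U)"
    then obtain x where x: "x \<in> A" "x \<in> D" "y = c x" using U by blast
    have "inv_into D c y = x" using x D by simp
    moreover have "inv_into (r ` D) (c \<circ> s) y = r x"
    proof -
      have "y = (c \<circ> s) (r x)" using x D left_inverse by auto
      with inv_into_f_f[OF inj_on_relabel_chart[OF ch(1)], of "r x"] x show ?thesis by simp
    qed
    ultimately show "(c' \<circ> f \<circ> inv_into D c) y = (c' \<circ> g \<circ> inv_into (r ` D) (c \<circ> s)) y"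
      using g x by simp
  qed
  then have "smooth_coord_map (coords (relabel r s M)) (coords N)
      ((c \<circ> s) ` (r ` A \<inter> r ` U)) (c' \<circ> g \<circ> inv_into (r ` D) (c \<circ> s))"
    unfolding img by (simp add: relabel_def)
  moreover have "(r ` D, c \<circ> s) \<in> charts (relabel r s M)" using ch by (force simp: relabel_def)
  moreover have "openin (mfd_top (relabel r s M)) (r ` U)" "p' \<in> r ` U" "r ` U \<subseteq> r ` D"
    using openin_relabel U p by auto
  moreover have "g ` (r ` A \<inter> r ` U) \<subseteq> D'" unfolding Int using U g by auto
  ultimately show "\<exists>(D, c)\<in>charts (relabel r s M). \<exists>(D', c')\<in>charts N. \<exists>U.
      openin (mfd_top (relabel r s M)) U \<and> p' \<in> U \<and> U \<subseteq> D \<and> g ` (r ` A \<inter> U) \<subseteq> D' \<and>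
      smooth_coord_map (coords (relabel r s M)) (coords N) (c ` (r ` A \<inter> U))
        (c' \<circ> g \<circ> inv_into D c)"
    using ch(2) by blast
qed

lemma smooth_map_on_to_relabel:
  assumes inj_N: "\<And>D c. (D, c) \<in> charts N \<Longrightarrow> inj_on c D"
    and f: "smooth_map_on N A M f" and g: "\<And>x. x \<in> A \<Longrightarrow> g x = r (f x)"
  shows "smooth_map_on N A (relabel r s M) g"
  unfolding smooth_map_on_def
proof (intro conjI ballI)
  show "A \<subseteq> points N" using f by (simp add: smooth_map_on_def)
  show "g ` A \<subseteq> points (relabel r s M)" using f g by (auto simp: smooth_map_on_def relabel_def)
  fix p assume "p \<in> A"
  then obtain D c D' c' U where ch: "(D, c) \<in> charts N" "(D', c') \<in> charts M"
    and U: "openin (mfd_top N) U" "p \<in> U" "U \<subseteq> D" "f ` (A \<inter> U) \<subseteq> D'"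
    and sm: "smooth_coord_map (coords N) (coords M) (c ` (A \<inter> U)) (c' \<circ> f \<circ> inv_into D c)"
    using f unfolding smooth_map_on_def by fast
  have "smooth_coord_map (coords N) (coords M) (c ` (A \<inter> U)) ((c' \<circ> s) \<circ> g \<circ> inv_into D c)"
  proof (rule smooth_coord_map_cong[OF sm])
    fix y assume "y \<in> c ` (A \<inter> U)"
    then obtain x where x: "x \<in> A" "x \<in> U" "y = c x" by blast
    then have "inv_into D c y = x" using U inj_N[OF ch(1)] by auto
    moreover have "f x \<in> points M" using x U charts_M[OF ch(2)] by blast
    ultimately show "(c' \<circ> f \<circ> inv_into D c) y = ((c' \<circ> s) \<circ> g \<circ> inv_into D c) y"
      using g x left_inverse by simp
  qed
  then have "smooth_coord_map (coords N) (coords (relabel r s M)) (c ` (A \<inter> U))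
      ((c' \<circ> s) \<circ> g \<circ> inv_into D c)" by (simp add: relabel_def)
  moreover have "(r ` D', c' \<circ> s) \<in> charts (relabel r s M)" using ch by (force simp: relabel_def)
  moreover have "g ` (A \<inter> U) \<subseteq> r ` D'" using U g by auto
  ultimately show "\<exists>(D, c)\<in>charts N. \<exists>(D', c')\<in>charts (relabel r s M). \<exists>U.
      openin (mfd_top N) U \<and> p \<in> U \<and> U \<subseteq> D \<and> g ` (A \<inter> U) \<subseteq> D' \<and>
      smooth_coord_map (coords N) (coords (relabel r s M)) (c ` (A \<inter> U))
        (c' \<circ> g \<circ> inv_into D c)"
    using ch(1) U by blast
qed

lemma diffeomorphism_relabel:
  assumes inj_N: "\<And>D c. (D, c) \<in> charts N \<Longrightarrow> inj_on c D"
    and \<phi>: "diffeomorphism M N \<phi>"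
  shows "diffeomorphism (relabel r s M) N (\<phi> \<circ> s)"
  unfolding diffeomorphism_def
proof (intro conjI)
  have bij: "bij_betw \<phi> (points M) (points N)" using \<phi> by (simp add: diffeomorphism_def)
  have "bij_betw s (r ` points M) (points M)"
    by (rule bij_betw_byWitness[where f' = r]) (auto simp: left_inverse)
  then show bij': "bij_betw (\<phi> \<circ> s) (points (relabel r s M)) (points N)"
    using bij by (simp add: relabel_def bij_betw_trans)
  have "smooth_map_on (relabel r s M) (r ` points M) N (\<phi> \<circ> s)"
    using \<phi> by (intro smooth_map_on_from_relabel[where f = \<phi>])
      (auto simp: diffeomorphism_def left_inverse)
  then show "smooth_map_on (relabel r s M) (points (relabel r s M)) N (\<phi> \<circ> s)"
    by (simp add: relabel_def)
  show "smooth_map_on N (points N) (relabel r s M) (inv_into (points (relabel r s M)) (\<phi> \<circ> s))"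
  proof (rule smooth_map_on_to_relabel[OF inj_N])
    show "smooth_map_on N (points N) M (inv_into (points M) \<phi>)"
      using \<phi> by (simp add: diffeomorphism_def)
    fix y assume "y \<in> points N"
    then obtain x where x: "x \<in> points M" "y = \<phi> x" using bij by (auto simp: bij_betw_def)
    have "inv_into (points M) \<phi> y = x" using x bij by (simp add: bij_betw_def)
    moreover have "inv_into (points (relabel r s M)) (\<phi> \<circ> s) ((\<phi> \<circ> s) (r x)) = r x"
      using x bij' by (intro inv_into_f_f) (auto simp: relabel_def bij_betw_def)
    ultimately show "inv_into (points (relabel r s M)) (\<phi> \<circ> s) y = r (inv_into (points M) \<phi> y)"
      using x left_inverse by simp
  qed
qed

end


section \<open>The bordism class of an empty manifold\<close>

text \<open>All points of the sum lie in the right summand, where \<open>Inr \<circ> projr\<close> is the identity up to the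
  type of the left summand.\<close>

lemma disjoint_sum_empty_mfd:
  "disjoint_sum (empty_mfd d :: ('b, nat) mfd) Q =
     relabel (Inr \<circ> projr) (Inr \<circ> projr) (disjoint_sum (empty_mfd d :: ('a, nat) mfd) Q)"
proof -
  have "(\<lambda>(D, c). ((Inr \<circ> projr) ` D, c \<circ> (Inr \<circ> projr))) `
        {(Inr ` D :: ('a + 'c) set, c \<circ> projr) | D c. (D, c) \<in> charts Q} =
      {(Inr ` D :: ('b + 'c) set, c \<circ> projr) | D c. (D, c) \<in> charts Q}" (is "?l = ?r")
  proof (intro equalityI subsetI)
    fix z assume "z \<in> ?l"
    then show "z \<in> ?r" by (fastforce simp: image_image comp_def)
  next
    fix z assume "z \<in> ?r"
    then obtain D c where "(D, c) \<in> charts Q" "z = (Inr ` D, c \<circ> projr)" by blast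
    then show "z \<in> ?l"
      by (intro image_eqI[where x = "(Inr ` D, c \<circ> projr)"]) (auto simp: image_image comp_def)
  qed
  from this[symmetric] show ?thesis
    by (simp add: disjoint_sum_def relabel_def empty_mfd_def Plus_def image_image)
qed

lemma bordant_empty_mfd:
  assumes Q: "closed_manifold d Q" and bordant: "bordant d (empty_mfd d :: ('a, nat) mfd) Q"
  shows "bordant d (empty_mfd d :: ('b, nat) mfd) Q"
proof -
  let ?M = "disjoint_sum (empty_mfd d :: ('a, nat) mfd) Q"
  obtain B :: "(real, nat) mfd" and \<phi> where B: "compact_bounded_manifold (Suc d) B"
    and \<phi>: "diffeomorphism ?M (boundary_mfd (Suc d) B) \<phi>"
    using bordant unfolding bordant_def by blast
  have local: "D \<subseteq> points Q \<and> inj_on c D" if "(D, c) \<in> charts Q" for D c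
    using Q that by (auto simp: closed_manifold_def smooth_manifold_def local_chart_def)
  have charts_M: "D \<subseteq> points ?M \<and> inj_on c D" if "(D, c) \<in> charts ?M" for D c
  proof -
    obtain D' c' where "(D', c') \<in> charts Q" "D = Inr ` D'" "c = c' \<circ> projr"
      using \<open>(D, c) \<in> charts ?M\<close> by (auto simp: disjoint_sum_def empty_mfd_def)
    with local[of D' c'] show ?thesis
      by (auto simp: disjoint_sum_def empty_mfd_def inj_on_def)
  qed
  have "diffeomorphism (relabel (Inr \<circ> projr) (Inr \<circ> projr) ?M :: ('b + _, nat) mfd)
      (boundary_mfd (Suc d) B) (\<phi> \<circ> (Inr \<circ> projr))"
  proof (rule diffeomorphism_relabel[OF _ charts_M _ \<phi>])
    show "(Inr \<circ> projr) ((Inr \<circ> projr) x :: 'b + _) = x" if "x \<in> points ?M" for x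
      using that by (auto simp: disjoint_sum_def empty_mfd_def)
    show "inj_on c D" if "(D, c) \<in> charts (boundary_mfd (Suc d) B)" for D c
      using that by (simp add: boundary_mfd_def submfd_def sub_charts_def)
  qed
  then show ?thesis
    using B unfolding bordant_def disjoint_sum_empty_mfd[where ?'a = 'a and ?'b = 'b] by blast
qed

lemma bordism_class_empty_mfd: "bordism_class d (empty_mfd d) = bordism_zero d"
  unfolding bordism_zero_def bordism_class_def
  by (intro Collect_cong conj_cong refl iffI; rule bordant_empty_mfd)

lemma family_mfd_Nil: "family_mfd W n k [] = empty_mfd (n - 1)"
  by (simp add: family_mfd_def disjoint_union_def empty_mfd_def)


section \<open>The empty solution\<close>

text \<open>A smooth solution is required to carry a half space structure, even if its boundary is empty.\<close>

definition empty_half_mfd :: "nat \<Rightarrow> ('a, nat) mfd" where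
  "empty_half_mfd n = \<lparr>points = {}, coords = {..<n}, bdcoords = {0}, charts = {}\<rparr>"

lemma compact_bounded_empty_half_mfd:
  assumes "1 \<le> n"
  shows "compact_bounded_manifold n (empty_half_mfd n)"
proof -
  have "openin (mfd_top (empty_half_mfd n)) U \<longleftrightarrow> U = {}" for U :: "'a set"
    by (subst openin_mfd_top) (auto simp: empty_half_mfd_def)
  then have top: "mfd_top (empty_half_mfd n :: ('a, nat) mfd) = trivial_topology"
    by (metis openin_topspace null_topspace_iff_trivial)
  have "second_countable (trivial_topology :: 'a topology)"
    unfolding second_countable_def by (intro exI[of _ "{}"]) simp
  then show ?thesis
    using assms unfolding compact_bounded_manifold_def smooth_manifold_def top
    by (simp add: empty_half_mfd_def Hausdorff_space_def)
qed

lemma integral_bordism_Nil: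
  assumes "1 \<le> n"
  shows "([], []) \<in> integral_bordism W n k E"
proof -
  let ?V = "empty_half_mfd n :: (real, nat) mfd"
  have "smooth_solution W n k E ?V F" for F
    using compact_bounded_empty_half_mfd[OF assms]
    by (auto simp: smooth_solution_def immersion_def smooth_map_on_def curve_in_def
        empty_half_mfd_def)
  moreover have "has_boundary W n k ?V F []" for F
    by (auto simp: has_boundary_def family_mfd_Nil diffeomorphism_def smooth_map_on_def
        empty_mfd_def boundary_mfd_def submfd_def boundary_def empty_half_mfd_def bij_betw_def)
  ultimately show ?thesis by (auto simp: integral_bordism_def)
qed


section \<open>Functions on the integral bordism group of a 0-crystal equation\<close>

text \<open>Triviality of the quotient makes the coset of \<open>g\<close> equal to the subalgebra; since the subalgebra
  contains the zero function, \<open>g\<close> lies in its own coset.\<close>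

lemma zero_crystal_imp_bordism_function:
  assumes "zero_crystal W n k E" and g: "g \<in> carrier (H_alg W n k E)"
  shows "g \<in> bordism_functions W n k E"
proof -
  let ?S = "integral_bordism_group W n k E" and ?B = "bordism_functions W n k E"
    and ?G = "add_monoid (H_alg W n k E)"
  have "?B #>\<^bsub>?G\<^esub> g \<in> carrier (cry W n k E)"
    using g by (auto simp: cry_def FactGroup_def RCOSETS_def)
  then have coset: "?B #>\<^bsub>?G\<^esub> g = ?B"
    using assms(1) by (simp add: zero_crystal_def cry_def FactGroup_def)
  have "(\<lambda>s\<in>?S. 0) \<in> ?B"
    by (auto simp: bordism_functions_def H_alg_def function_algebra_def integral_class_def
        integral_bordism_group_def quotient_def intro!: bexI[of _ "\<lambda>_. 0"])
  then have "(\<lambda>s\<in>?S. 0) \<otimes>\<^bsub>?G\<^esub> g \<in> ?B #>\<^bsub>?G\<^esub> g"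
    by (auto simp: r_coset_def)
  moreover have "(\<lambda>s\<in>?S. 0) \<otimes>\<^bsub>?G\<^esub> g = g"
    using g by (auto simp: H_alg_def function_algebra_def PiE_def extensional_def restrict_def)
  ultimately show ?thesis using coset by simp
qed

text \<open>A function that depends only on the unoriented class cannot separate two integral classes
  with the same unoriented class, but real functions on the integral bordism group separate any
  two integral classes.\<close>

lemma zero_crystal_imp_integral_class_eq:
  assumes "zero_crystal W n k E"
    and Ns: "Ns \<in> lists (closed_admissible W n k E)"
    and Ms: "Ms \<in> lists (closed_admissible W n k E)"
    and "bordism_class (n - 1) (family_mfd W n k Ns) = bordism_class (n - 1) (family_mfd W n k Ms)"
  shows "integral_class W n k E Ns = integral_class W n k E Ms"
proof -
  let ?S = "integral_bordism_group W n k E" and ?c = "integral_class W n k E"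
  define g :: "'a jet set list set \<Rightarrow> real" where "g = (\<lambda>s\<in>?S. if s = ?c Ms then 1 else 0)"
  have "g \<in> carrier (H_alg W n k E)" by (simp add: g_def H_alg_def function_algebra_def)
  then have "g \<in> bordism_functions W n k E"
    by (rule zero_crystal_imp_bordism_function[OF assms(1)])
  then obtain \<phi> where "\<forall>Ns\<in>lists (closed_admissible W n k E).
      g (?c Ns) = \<phi> (bordism_class (n - 1) (family_mfd W n k Ns))"
    by (auto simp: bordism_functions_def)
  then have "g (?c Ns) = g (?c Ms)" using assms by simp
  moreover have "?c Ns \<in> ?S" "?c Ms \<in> ?S"
    using Ns Ms by (simp_all add: integral_class_def integral_bordism_group_def quotientI)
  ultimately show ?thesis by (simp add: g_def split: if_splits)
qed


section \<open>Existence of the bounding solution\<close>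

theorem corollary3p23:
  fixes n m k :: nat
    and W :: "('w, nat) mfd" and M :: "('m, nat) mfd" and pr :: "'w \<Rightarrow> 'm"
    and E N0 N1 :: "'w jet set"
  assumes "1 \<le> n"
    and "fibered_manifold n m W M pr"
    and "is_pde W n k E"
    and "formally_integrable W n k E"
    and "completely_integrable W n k E"
    and "zero_crystal W n k E"
    and "N0 \<in> closed_admissible W n k E"
    and "N1 \<in> closed_admissible W n k E"
    and "bordism_class (n - 1) (family_mfd W n k [N0, N1]) = bordism_zero (n - 1)"
  shows "\<exists>V F. smooth_solution W n k E V F \<and> has_boundary W n k V F [N0, N1]"
proof -
  have "integral_class W n k E [N0, N1] = integral_class W n k E []"
  proof (rule zero_crystal_imp_integral_class_eq[OF assms(6)])
    show "bordism_class (n - 1) (family_mfd W n k [N0, N1]) =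
        bordism_class (n - 1) (family_mfd W n k [])"
      using assms(9) by (simp add: family_mfd_Nil bordism_class_empty_mfd)
  qed (use assms(7,8) in auto)
  moreover have "[] \<in> integral_class W n k E []"
    using integral_bordism_Nil[OF assms(1)] by (simp add: integral_class_def)
  ultimately have "[] \<in> integral_class W n k E [N0, N1]" by simp
  then have "([N0, N1], []) \<in> integral_bordism W n k E" by (simp add: integral_class_def)
  then show ?thesis by (simp add: integral_bordism_def)
qed

end
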